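(* Let $G$ be a graph with minimum degree $\delta(G)\ge 7$. Let $\mathcal F(G)$ be the family of graphs obtained from $G$ by finite sequences of $\Delta$-Y and Y-$\Delta$ moves, and let $\mathcal F'(G)$ be the family of graphs obtained from $G$ by finite sequences of $\Delta$-Y moves only. Then $$\mathcal F(G)=\mathcal F'(G).$$
   Context: A graph is a finite simple undirected graph. A triangle is a 3-cycle. A $\Delta$-Y move on a graph $H$ at a triangle $T\subset H$ removes the three edges of $T$ and adds a new vertex adjacent to exactly the three vertices of $T$. A Y-$\Delta$ move on $H$ at a vertex $x$ of degree $3$ removes $x$ and adds those edges among the three neighbours of $x$ that are missing, so that the neighbours form a triangle (the graph stays simple). Sequences may be empty. Labelling convention. Moves keep the names of surviving vertices, and the vertex added by a $\Delta$-Y move is given a fresh name (not in $V(G)$ and not used in any earlier graph of the sequence). Two graphs obtained from $G$ that differ only by renaming vertices not in $V(G)$ are regarded as the same. *)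

theory Defs
  imports "HOL-Library.Infinite_Typeclass"
begin

record 'a sgraph =
  verts :: "'a set"
  edges :: "'a set set"

definition simple_graph :: "'a sgraph \<Rightarrow> bool" where
  "simple_graph H \<longleftrightarrow> finite (verts H) \<and> (\<forall>e\<in>edges H. e \<subseteq> verts H \<and> card e = 2)"

definition neighbours :: "'a sgraph \<Rightarrow> 'a \<Rightarrow> 'a set" where
  "neighbours H v = {u. {v, u} \<in> edges H}"

definition degree :: "'a sgraph \<Rightarrow> 'a \<Rightarrow> nat" where
  "degree H v = card (neighbours H v)"

text \<open>For the graph without vertices, \<open>min_degree\<close> is the unspecified number \<open>Min {}\<close>.\<close>

definition min_degree :: "'a sgraph \<Rightarrow> nat" where
  "min_degree H = Min (degree H ` verts H)"

definition triangle :: "'a sgraph \<Rightarrow> 'a \<Rightarrow> 'a \<Rightarrow> 'a \<Rightarrow> bool" where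
  "triangle H a b c \<longleftrightarrow> distinct [a, b, c] \<and> {{a, b}, {b, c}, {a, c}} \<subseteq> edges H"

definition delta_y :: "'a sgraph \<Rightarrow> 'a \<Rightarrow> 'a \<Rightarrow> 'a \<Rightarrow> 'a \<Rightarrow> 'a sgraph" where
  "delta_y H a b c x =
     \<lparr> verts = insert x (verts H),
       edges = (edges H - {{a, b}, {b, c}, {a, c}}) \<union> {{x, a}, {x, b}, {x, c}} \<rparr>"

definition y_delta :: "'a sgraph \<Rightarrow> 'a \<Rightarrow> 'a sgraph" where
  "y_delta H x =
     \<lparr> verts = verts H - {x},
       edges = {e \<in> edges H. x \<notin> e} \<union>
               {{u, v} | u v. u \<in> neighbours H x \<and> v \<in> neighbours H x \<and> u \<noteq> v} \<rparr>"

text \<open>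
  The steps act on pairs \<open>(U, H)\<close>, where \<open>H\<close> is the current graph and \<open>U\<close> is the set of all vertex
  names used so far. Names of deleted vertices remain in \<open>U\<close>, so they are never used again.
\<close>

inductive delta_y_step :: "'a set \<times> 'a sgraph \<Rightarrow> 'a set \<times> 'a sgraph \<Rightarrow> bool" where
  "triangle H a b c \<Longrightarrow> x \<notin> U \<Longrightarrow> delta_y_step (U, H) (insert x U, delta_y H a b c x)"

inductive y_delta_step :: "'a set \<times> 'a sgraph \<Rightarrow> 'a set \<times> 'a sgraph \<Rightarrow> bool" where
  "x \<in> verts H \<Longrightarrow> degree H x = 3 \<Longrightarrow> y_delta_step (U, H) (U, y_delta H x)"

definition obtained ::
  "('a set \<times> 'a sgraph \<Rightarrow> 'a set \<times> 'a sgraph \<Rightarrow> bool) \<Rightarrow> 'a sgraph \<Rightarrow> 'a sgraph set" where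
  "obtained step G = {H. \<exists>U. step\<^sup>*\<^sup>* (verts G, G) (U, H)}"

text \<open>\<open>H\<close> and \<open>K\<close> differ only by a renaming of vertices that are not vertices of \<open>G\<close>.\<close>

definition renaming :: "'a sgraph \<Rightarrow> ('a sgraph \<times> 'a sgraph) set" where
  "renaming G = {(H, K). simple_graph H \<and> simple_graph K \<and>
     (\<exists>f. bij_betw f (verts H) (verts K) \<and>
          (\<forall>v \<in> verts H \<inter> verts G. f v = v) \<and>
          (\<forall>v \<in> verts H - verts G. f v \<notin> verts G) \<and>
          edges K = image f ` edges H)}"

text \<open>The members of the families are classes of graphs modulo \<^term>\<open>renaming G\<close>.\<close>

definition family :: "'a sgraph \<Rightarrow> 'a sgraph set set" where
  "family G = obtained (sup delta_y_step y_delta_step) G // renaming G"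

definition delta_y_family :: "'a sgraph \<Rightarrow> 'a sgraph set set" where
  "delta_y_family G = obtained delta_y_step G // renaming G"

lemma equiv_renaming: "equiv {H. simple_graph H} (renaming G)"
proof (rule equivI)
  show "renaming G \<subseteq> {H. simple_graph H} \<times> {H. simple_graph H}"
    by (auto simp: renaming_def)
  show "refl_on {H. simple_graph H} (renaming G)"
    by (auto simp: renaming_def refl_on_def intro!: exI[of _ id])
  show "sym (renaming G)"
  proof (rule symI)
    fix H K assume "(H, K) \<in> renaming G"
    then obtain f where s: "simple_graph H" "simple_graph K"
      and f: "bij_betw f (verts H) (verts K)"
        "\<And>v. v \<in> verts H \<Longrightarrow> v \<in> verts G \<Longrightarrow> f v = v"
        "\<And>v. v \<in> verts H \<Longrightarrow> v \<notin> verts G \<Longrightarrow> f v \<notin> verts G"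
        "edges K = image f ` edges H"
      by (auto simp: renaming_def)
    let ?g = "inv_into (verts H) f"
    have inj: "inj_on f (verts H)" using f(1) by (simp add: bij_betw_def)
    have g: "?g w \<in> verts H" "f (?g w) = w" if "w \<in> verts K" for w
      using f(1) that by (auto simp: bij_betw_def inv_into_into f_inv_into_f)
    have "?g ` (f ` e) = e" if "e \<in> edges H" for e
      using s(1) that inj by (intro inv_into_image_cancel) (auto simp: simple_graph_def)
    then have "edges H = image ?g ` edges K"
      unfolding f(4) by (simp add: image_image)
    moreover have "?g w = w" if "w \<in> verts K" "w \<in> verts G" for w
      using f(2,3) g that by metis
    moreover have "?g w \<notin> verts G" if "w \<in> verts K" "w \<notin> verts G" for w
      using f(2) g that by metis
    moreover have "bij_betw ?g (verts K) (verts H)"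
      using f(1) by (rule bij_betw_inv_into)
    ultimately show "(K, H) \<in> renaming G"
      using s unfolding renaming_def by blast
  qed
  show "trans (renaming G)"
  proof (rule transI)
    fix H K L assume "(H, K) \<in> renaming G" "(K, L) \<in> renaming G"
    then obtain f g where s: "simple_graph H" "simple_graph L"
      and f: "bij_betw f (verts H) (verts K)"
        "\<And>v. v \<in> verts H \<Longrightarrow> v \<in> verts G \<Longrightarrow> f v = v"
        "\<And>v. v \<in> verts H \<Longrightarrow> v \<notin> verts G \<Longrightarrow> f v \<notin> verts G"
        "edges K = image f ` edges H"
      and g: "bij_betw g (verts K) (verts L)"
        "\<And>v. v \<in> verts K \<Longrightarrow> v \<in> verts G \<Longrightarrow> g v = v"
        "\<And>v. v \<in> verts K \<Longrightarrow> v \<notin> verts G \<Longrightarrow> g v \<notin> verts G"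
        "edges L = image g ` edges K"
      by (auto simp: renaming_def)
    have fK: "f v \<in> verts K" if "v \<in> verts H" for v
      using f(1) that by (auto simp: bij_betw_def)
    have "edges L = image (g \<circ> f) ` edges H"
      unfolding f(4) g(4) by (simp add: image_image image_comp comp_def)
    moreover have "bij_betw (g \<circ> f) (verts H) (verts L)"
      using f(1) g(1) by (rule bij_betw_trans)
    moreover have "(g \<circ> f) v = v" if "v \<in> verts H" "v \<in> verts G" for v
      using f(2) g(2) fK that by (metis comp_apply)
    moreover have "(g \<circ> f) v \<notin> verts G" if "v \<in> verts H" "v \<notin> verts G" for v
      using f(3) g(3) fK that by simp
    ultimately show "(H, L) \<in> renaming G"
      using s unfolding renaming_def by blast
  qed
qed

lemma simple_graph_delta_y:
  assumes "simple_graph H" "triangle H a b c" "x \<notin> verts H"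
  shows "simple_graph (delta_y H a b c x)"
proof -
  have "{a, b} \<in> edges H" "{a, c} \<in> edges H"
    using assms(2) by (simp_all add: triangle_def)
  then have "{a, b} \<subseteq> verts H" "{a, c} \<subseteq> verts H"
    using assms(1) by (simp_all only: simple_graph_def)
  then have v: "a \<in> verts H" "b \<in> verts H" "c \<in> verts H"
    by simp_all
  then have "x \<noteq> a" "x \<noteq> b" "x \<noteq> c"
    using assms(3) by auto
  then have new: "e \<subseteq> insert x (verts H) \<and> card e = 2" if "e \<in> {{x, a}, {x, b}, {x, c}}" for e
    using that v by auto
  have old: "e \<subseteq> insert x (verts H) \<and> card e = 2" if "e \<in> edges H" for e
    using assms(1) that unfolding simple_graph_def by blast
  have "e \<subseteq> insert x (verts H) \<and> card e = 2" if "e \<in> edges (delta_y H a b c x)" for e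
    using that new old unfolding delta_y_def sgraph.simps
    by (metis DiffD1 UnE)
  then show ?thesis
    using assms(1) by (simp add: simple_graph_def delta_y_def)
qed

lemma simple_graph_y_delta:
  assumes "simple_graph H"
  shows "simple_graph (y_delta H x)"
proof -
  have "u \<in> verts H \<and> u \<noteq> x" if "u \<in> neighbours H x" for u
  proof -
    have "{x, u} \<subseteq> verts H" "card {x, u} = 2"
      using assms that unfolding simple_graph_def neighbours_def by blast+
    then show ?thesis by auto
  qed
  then show ?thesis
    using assms by (auto simp: simple_graph_def y_delta_def)
qed

end

theory Submission
  imports Defs
begin

text \<open>
  A vertex added by a \<open>\<Delta>\<close>-Y move has three pairwise nonadjacent neighbours, and later \<open>\<Delta>\<close>-Y moves
  never join two old vertices. Hence it never lies on a triangle, and every \<open>\<Delta>\<close>-Y move acts on a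
  triangle of \<open>G\<close> all of whose edges are still present. So the graphs reached by \<open>\<Delta>\<close>-Y moves alone
  are exactly the graphs described by a family of pairwise edge-disjoint triangles of \<open>G\<close> indexed
  by the new vertices (lemmas \<open>stars_insert\<close> and \<open>triangle_stars\<close>).

  If \<open>k\<close> of these triangles contain a vertex \<open>v\<close> of \<open>G\<close>, then they use \<open>2 * k\<close> of its edges and
  replace them by \<open>k\<close> edges, so the degree of \<open>v\<close> is still at least half of its degree in \<open>G\<close>
  (\<open>degree_le_degree_stars\<close>). When the minimum degree of \<open>G\<close> is at least 7, this is more than 3.
  A Y-\<open>\<Delta>\<close> move therefore acts on a new vertex and undoes the move that created it
  (\<open>y_delta_delta_y\<close>), which amounts to deleting one triangle from the family. The family that is
  left can again be realised by \<open>\<Delta>\<close>-Y moves alone, with the same names.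
\<close>

section \<open>Packings of edge-disjoint triangles\<close>

text \<open>The two-element subsets of \<open>T\<close>: the edges of the triangle on \<open>T\<close> when \<open>T\<close> has three elements.\<close>

definition pairs :: "'a set \<Rightarrow> 'a set set" where
  "pairs T = {e. e \<subseteq> T \<and> card e = 2}"

text \<open>
  Pairwise edge-disjoint triangles of \<open>G\<close>, given by their vertex sets \<open>t s\<close> and indexed by names
  \<open>s \<in> S\<close> that are not vertices of \<open>G\<close>. The values of \<open>t\<close> outside \<open>S\<close> are irrelevant.
\<close>

definition triangle_packing :: "'a sgraph \<Rightarrow> 'a set \<Rightarrow> ('a \<Rightarrow> 'a set) \<Rightarrow> bool" where
  "triangle_packing G S t \<longleftrightarrow> finite S \<and> S \<inter> verts G = {} \<and>
     (\<forall>s\<in>S. card (t s) = 3 \<and> pairs (t s) \<subseteq> edges G) \<and>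
     (\<forall>s\<in>S. \<forall>s'\<in>S. s \<noteq> s' \<longrightarrow> pairs (t s) \<inter> pairs (t s') = {})"

text \<open>The graph \<open>G\<close> with the triangle on \<open>t s\<close> replaced by a star with centre \<open>s\<close>, for all \<open>s \<in> S\<close>.\<close>

definition stars :: "'a sgraph \<Rightarrow> 'a set \<Rightarrow> ('a \<Rightarrow> 'a set) \<Rightarrow> 'a sgraph" where
  "stars G S t =
     \<lparr> verts = S \<union> verts G,
       edges = (edges G - (\<Union>s\<in>S. pairs (t s))) \<union> (\<Union>s\<in>S. (\<lambda>v. {s, v}) ` t s) \<rparr>"

lemma doubleton_in_pairs: "{u, v} \<in> pairs T \<longleftrightarrow> u \<in> T \<and> v \<in> T \<and> u \<noteq> v"
  by (auto simp: pairs_def card_insert_if)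

lemma pairs_eq: "pairs T = {{u, v} | u v. u \<in> T \<and> v \<in> T \<and> u \<noteq> v}"
  unfolding pairs_def by (auto simp: card_2_iff)

lemma pairs_triple:
  assumes "distinct [a, b, c]"
  shows "pairs {a, b, c} = {{a, b}, {b, c}, {a, c}}"
proof (rule set_eqI)
  fix e
  show "e \<in> pairs {a, b, c} \<longleftrightarrow> e \<in> {{a, b}, {b, c}, {a, c}}"
  proof
    assume "e \<in> pairs {a, b, c}"
    then obtain u v where "e = {u, v}" "u \<in> {a, b, c}" "v \<in> {a, b, c}" "u \<noteq> v"
      unfolding pairs_eq by blast
    then show "e \<in> {{a, b}, {b, c}, {a, c}}" by auto
  next
    assume "e \<in> {{a, b}, {b, c}, {a, c}}"
    then show "e \<in> pairs {a, b, c}"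
      using assms by (auto simp: doubleton_in_pairs)
  qed
qed

lemma triangle_iff_pairs:
  "triangle H a b c \<longleftrightarrow> distinct [a, b, c] \<and> pairs {a, b, c} \<subseteq> edges H"
proof (cases "distinct [a, b, c]")
  case True
  then show ?thesis unfolding triangle_def pairs_triple[OF True] by blast
next
  case False
  then show ?thesis unfolding triangle_def by blast
qed

lemma Union_pairs:
  assumes "card T = 3"
  shows "\<Union> (pairs T) = T"
proof -
  obtain a b c where "T = {a, b, c}" "a \<noteq> b" "b \<noteq> c" "a \<noteq> c"
    using assms by (auto simp: card_3_iff)
  then show ?thesis by (auto simp: pairs_triple)
qed

lemma edge_subset_verts:
  assumes "simple_graph G" "e \<in> edges G"
  shows "e \<subseteq> verts G"
  using assms unfolding simple_graph_def by blast

lemma triangle_packing_subset_verts: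
  assumes "simple_graph G" "triangle_packing G S t" "s \<in> S"
  shows "t s \<subseteq> verts G"
proof -
  have "card (t s) = 3" "pairs (t s) \<subseteq> edges G"
    using assms by (auto simp: triangle_packing_def)
  then show ?thesis
    using Union_pairs[of "t s"] edge_subset_verts[OF assms(1)] by blast
qed

lemma triangle_packing_mono:
  assumes "triangle_packing G S t" "S' \<subseteq> S"
  shows "triangle_packing G S' t"
proof -
  have "finite S'" "S' \<inter> verts G = {}"
    using assms finite_subset[of S' S] unfolding triangle_packing_def by blast+
  then show ?thesis
    using assms unfolding triangle_packing_def unfolding subset_iff[of S' S] by simp
qed

lemma stars_empty: "stars G {} t = G"
  by (simp add: stars_def)

lemma stars_cong:
  assumes "\<And>s. s \<in> S \<Longrightarrow> t s = t' s"
  shows "stars G S t = stars G S t'"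
  using assms by (simp add: stars_def)

lemma stars_edge_at_centre:
  assumes "simple_graph G" "triangle_packing G S t" "s \<in> S"
  shows "{s, v} \<in> edges (stars G S t) \<longleftrightarrow> v \<in> t s"
proof
  have s: "s \<notin> verts G" using assms by (auto simp: triangle_packing_def)
  assume "{s, v} \<in> edges (stars G S t)"
  moreover have "{s, v} \<notin> edges G"
    using edge_subset_verts[OF assms(1)] s by blast
  ultimately obtain s' u where *: "s' \<in> S" "u \<in> t s'" "{s, v} = {s', u}"
    by (auto simp: stars_def)
  then have "u \<in> verts G"
    using triangle_packing_subset_verts[OF assms(1,2)] by blast
  then have "s = s'" "v = u" using * s by (auto simp: doubleton_eq_iff)
  then show "v \<in> t s" using * by simp
next
  assume "v \<in> t s"
  then show "{s, v} \<in> edges (stars G S t)"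
    using assms(3) by (auto simp: stars_def)
qed

lemma stars_edge_within_verts:
  assumes "triangle_packing G S t" "e \<subseteq> verts G"
  shows "e \<in> edges (stars G S t) \<longleftrightarrow> e \<in> edges G \<and> (\<forall>s\<in>S. e \<notin> pairs (t s))"
proof -
  have "S \<inter> verts G = {}" using assms by (simp add: triangle_packing_def)
  then have "e \<notin> (\<Union>s\<in>S. (\<lambda>v. {s, v}) ` t s)"
    using assms(2) by fastforce
  then show ?thesis unfolding stars_def sgraph.simps by blast
qed

section \<open>\<open>\<Delta>\<close>-Y moves enlarge the packing\<close>

text \<open>
  Enlarging the packing by one triangle is a \<open>\<Delta>\<close>-Y move, since by edge-disjointness the new
  triangle has survived the earlier replacements.
\<close>

lemma stars_insert:
  assumes G: "simple_graph G" and p: "triangle_packing G (insert x S) t" and "x \<notin> S"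
    and abc: "t x = {a, b, c}"
  shows "triangle (stars G S t) a b c"
    and "stars G (insert x S) t = delta_y (stars G S t) a b c x"
proof -
  have d: "distinct [a, b, c]"
    using p abc by (auto simp: triangle_packing_def card_insert_if split: if_splits)
  have S: "triangle_packing G S t"
    using p by (rule triangle_packing_mono) auto
  have E: "pairs (t x) \<subseteq> edges G"
    using p by (auto simp: triangle_packing_def)
  have disj: "pairs (t s) \<inter> pairs (t x) = {}" if "s \<in> S" for s
    using p that \<open>x \<notin> S\<close> unfolding triangle_packing_def
    by (metis insert_iff)
  have star: "{s, v} \<notin> pairs (t x)" if "s \<in> S" for s v
    using E edge_subset_verts[OF G] S that unfolding triangle_packing_def by blast
  show "triangle (stars G S t) a b c"
    unfolding triangle_iff_pairs using d E disj abc by (auto simp: stars_def)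
  have "edges (stars G S t) - pairs (t x) =
      (edges G - (\<Union>s\<in>insert x S. pairs (t s))) \<union> (\<Union>s\<in>S. (\<lambda>v. {s, v}) ` t s)"
    using star by (auto simp: stars_def)
  then have "edges (stars G (insert x S) t) =
      (edges (stars G S t) - pairs (t x)) \<union> (\<lambda>v. {x, v}) ` t x"
    by (auto simp: stars_def)
  then have "edges (stars G (insert x S) t) = edges (delta_y (stars G S t) a b c x)"
    using abc pairs_triple[OF d] by (simp add: delta_y_def)
  moreover have "verts (stars G (insert x S) t) = verts (delta_y (stars G S t) a b c x)"
    by (simp add: stars_def delta_y_def)
  ultimately show "stars G (insert x S) t = delta_y (stars G S t) a b c x"
    by (simp add: sgraph.equality)
qed

text \<open>No centre of a star lies on a triangle, because its neighbours are pairwise nonadjacent.\<close>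

lemma centre_not_in_triangle:
  assumes G: "simple_graph G" and p: "triangle_packing G S t" and "s \<in> S"
  shows "\<not> triangle (stars G S t) s b c"
proof
  assume "triangle (stars G S t) s b c"
  then have e: "{s, b} \<in> edges (stars G S t)" "{s, c} \<in> edges (stars G S t)"
      "{b, c} \<in> edges (stars G S t)" "b \<noteq> c"
    by (auto simp: triangle_def)
  then have bc: "b \<in> t s" "c \<in> t s"
    by (simp_all add: stars_edge_at_centre[OF G p \<open>s \<in> S\<close>])
  then have "{b, c} \<subseteq> verts G"
    using triangle_packing_subset_verts[OF G p \<open>s \<in> S\<close>] by blast
  then have "{b, c} \<notin> pairs (t s)"
    using e(3) \<open>s \<in> S\<close> stars_edge_within_verts[OF p] by blast
  with bc e(4) show False by (simp add: doubleton_in_pairs)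
qed

lemma triangle_stars:
  assumes G: "simple_graph G" and p: "triangle_packing G S t"
    and tri: "triangle (stars G S t) a b c" and x: "x \<notin> S" "x \<notin> verts G"
  shows "triangle_packing G (insert x S) (t(x := {a, b, c}))"
proof -
  have d: "distinct [a, b, c]" and E: "pairs {a, b, c} \<subseteq> edges (stars G S t)"
    using tri by (simp_all add: triangle_iff_pairs)
  have rot: "triangle (stars G S t) b c a" "triangle (stars G S t) c a b"
    using tri by (auto simp: triangle_def insert_commute)
  have "a \<notin> S" "b \<notin> S" "c \<notin> S"
    using centre_not_in_triangle[OF G p] tri rot by blast+
  then have "e \<inter> S = {}" if "e \<in> pairs {a, b, c}" for e
    using that by (auto simp: pairs_def)
  then have e: "e \<in> edges G \<and> (\<forall>s\<in>S. e \<notin> pairs (t s))" if "e \<in> pairs {a, b, c}" for e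
    using that subsetD[OF E that] by (auto simp: stars_def)
  define t' where "t' = t(x := {a, b, c})"
  have t': "t' x = {a, b, c}" "\<And>s. s \<in> S \<Longrightarrow> t' s = t s"
    using x by (auto simp: t'_def)
  have "card (t' x) = 3" using d t' by simp
  moreover have "pairs (t' x) \<subseteq> edges G"
    unfolding t' using e by blast
  moreover have "pairs (t' s) \<inter> pairs (t' x) = {}" if "s \<in> S" for s
    unfolding t'(1) t'(2)[OF that] using e that by blast
  moreover have "triangle_packing G S t'"
    using p t'(2) by (simp add: triangle_packing_def)
  ultimately have "triangle_packing G (insert x S) t'"
    using x by (simp add: triangle_packing_def Int_commute)
  then show ?thesis by (simp add: t'_def)
qed

section \<open>Degrees of the original vertices\<close>

text \<open>
  The edge-disjoint triangles through \<open>v\<close> contribute two neighbours each in \<open>G\<close>, and one each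
  after their replacement by stars.
\<close>

lemma degree_le_degree_stars:
  assumes G: "simple_graph G" and p: "triangle_packing G S t" and v: "v \<in> verts G"
  shows "degree G v \<le> 2 * degree (stars G S t) v"
proof -
  \<comment> \<open>\<open>A\<close> is the set of centres joined to \<open>v\<close>; \<open>R\<close> and \<open>M\<close> are the lost and the kept neighbours.\<close>
  define A where "A = {s \<in> S. v \<in> t s}"
  define R where "R = (\<Union>s\<in>A. t s - {v})"
  define M where "M = {u. {v, u} \<in> edges G \<and> (\<forall>s\<in>S. {v, u} \<notin> pairs (t s))}"
  have fin: "finite (verts G)" "finite S"
    using G p by (auto simp: simple_graph_def triangle_packing_def)
  have M: "M \<subseteq> verts G"
    using edge_subset_verts[OF G] by (auto simp: M_def)
  have finA: "finite A" using fin by (simp add: A_def)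
  have "card R \<le> (\<Sum>s\<in>A. card (t s - {v}))"
    unfolding R_def using finA by (rule card_UN_le)
  also have "\<dots> = (\<Sum>s\<in>A. 2)"
    using p by (intro sum.cong) (auto simp: A_def triangle_packing_def)
  finally have R: "card R \<le> 2 * card A" by simp
  have "neighbours G v \<subseteq> R \<union> M"
    by (auto simp: neighbours_def R_def M_def A_def doubleton_in_pairs)
  moreover have "finite R"
    unfolding R_def A_def
    using fin triangle_packing_subset_verts[OF G p] by (auto intro: finite_subset)
  ultimately have "degree G v \<le> card R + card M"
    unfolding degree_def
    by (meson M card_Un_le card_mono fin(1) finite_UnI finite_subset le_trans)
  moreover have "A \<union> M \<subseteq> neighbours (stars G S t) v"
    by (auto simp: A_def M_def neighbours_def stars_def)
  moreover have "neighbours (stars G S t) v \<subseteq> S \<union> verts G"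
    using edge_subset_verts[OF G] triangle_packing_subset_verts[OF G p]
    by (fastforce simp: neighbours_def stars_def doubleton_eq_iff)
  moreover have "card (A \<union> M) = card A + card M"
    using M p finA fin by (intro card_Un_disjoint)
      (auto simp: A_def triangle_packing_def intro: finite_subset)
  ultimately have "card A + card M \<le> degree (stars G S t) v"
    unfolding degree_def using fin
    by (metis card_mono finite_UnI finite_subset)
  with R \<open>degree G v \<le> card R + card M\<close> show ?thesis by linarith
qed

section \<open>Undoing a \<open>\<Delta>\<close>-Y move\<close>

lemma y_delta_delta_y:
  assumes tri: "triangle K a b c" and fresh: "\<And>e. e \<in> edges K \<Longrightarrow> x \<notin> e" and "x \<notin> verts K"
  shows "y_delta (delta_y K a b c x) x = K"
proof -
  have d: "distinct [a, b, c]" and E: "pairs {a, b, c} \<subseteq> edges K"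
    using tri by (simp_all add: triangle_iff_pairs)
  have "neighbours (delta_y K a b c x) x = {a, b, c}"
    using fresh by (auto simp: neighbours_def delta_y_def doubleton_eq_iff)
  then have "edges (y_delta (delta_y K a b c x) x) =
      {e \<in> edges (delta_y K a b c x). x \<notin> e} \<union> pairs {a, b, c}"
    by (simp only: y_delta_def sgraph.simps pairs_eq)
  also have "{e \<in> edges (delta_y K a b c x). x \<notin> e} = edges K - pairs {a, b, c}"
    unfolding pairs_triple[OF d] delta_y_def using fresh by auto
  also have "edges K - pairs {a, b, c} \<union> pairs {a, b, c} = edges K"
    using E by blast
  finally show ?thesis
    using \<open>x \<notin> verts K\<close> by (simp add: y_delta_def delta_y_def sgraph.equality)
qed

lemma y_delta_stars:
  assumes G: "simple_graph G" and p: "triangle_packing G S t" and "x \<in> S"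
  shows "y_delta (stars G S t) x = stars G (S - {x}) t"
proof -
  have S: "insert x (S - {x}) = S" using \<open>x \<in> S\<close> by blast
  have x: "x \<notin> verts G" and "card (t x) = 3"
    using p \<open>x \<in> S\<close> by (auto simp: triangle_packing_def)
  then obtain a b c where abc: "t x = {a, b, c}"
    by (auto simp: card_3_iff)
  note ins = stars_insert[of G x "S - {x}" t, unfolded S, OF G p _ abc]
  have "x \<notin> e" if "e \<in> edges (stars G (S - {x}) t)" for e
    using that x edge_subset_verts[OF G] triangle_packing_subset_verts[OF G p]
    by (auto simp: stars_def)
  moreover have "x \<notin> verts (stars G (S - {x}) t)"
    using x by (simp add: stars_def)
  ultimately show ?thesis
    using ins y_delta_delta_y by (metis Diff_iff singletonI)
qed

section \<open>Graphs reached from \<open>G\<close>\<close>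

lemma delta_y_reaches_stars:
  assumes G: "simple_graph G" and p: "triangle_packing G S t"
  shows "delta_y_step\<^sup>*\<^sup>* (verts G, G) (S \<union> verts G, stars G S t)"
proof -
  have "finite S" using p by (simp add: triangle_packing_def)
  then show ?thesis using p
  proof (induction S)
    case empty
    then show ?case by (simp add: stars_empty)
  next
    case (insert x S)
    have "card (t x) = 3" "x \<notin> verts G"
      using insert.prems by (auto simp: triangle_packing_def)
    then obtain a b c where abc: "t x = {a, b, c}"
      by (auto simp: card_3_iff)
    note ins = stars_insert[OF G insert.prems insert.hyps(2) abc]
    have "delta_y_step (S \<union> verts G, stars G S t)
        (insert x (S \<union> verts G), delta_y (stars G S t) a b c x)"
      using ins(1) insert.hyps(2) \<open>x \<notin> verts G\<close> by (intro delta_y_step.intros) auto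
    moreover have "triangle_packing G S t"
      using insert.prems by (rule triangle_packing_mono) auto
    ultimately show ?case
      using insert.IH ins(2) by (simp add: rtranclp.rtrancl_into_rtrancl)
  qed
qed

text \<open>
  The set \<open>U\<close> of used names may be larger than \<open>S \<union> verts G\<close>, because it retains the names of
  deleted vertices; the inclusion is what makes the next name fresh.
\<close>

lemma reachable_is_stars:
  assumes G: "simple_graph G" and deg: "\<And>v. v \<in> verts G \<Longrightarrow> degree G v \<ge> 7"
    and "(sup delta_y_step y_delta_step)\<^sup>*\<^sup>* (verts G, G) (U, H)"
  shows "\<exists>S t. triangle_packing G S t \<and> H = stars G S t \<and> S \<union> verts G \<subseteq> U"
  using assms(3)
proof (induction rule: rtranclp_induct2)
  case refl
  have "triangle_packing G {} (\<lambda>_. {})" by (simp add: triangle_packing_def)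
  then show ?case
    by (intro exI[of _ "{}"] exI[of _ "\<lambda>_. {}"]) (simp add: stars_empty)
next
  case (step U H U' H')
  then obtain S t where p: "triangle_packing G S t" and H: "H = stars G S t"
    and U: "S \<union> verts G \<subseteq> U" by blast
  from step.hyps(2) have "delta_y_step (U, H) (U', H') \<or> y_delta_step (U, H) (U', H')"
    by simp
  then show ?case
  proof
    assume "delta_y_step (U, H) (U', H')"
    then obtain a b c x where tri: "triangle H a b c" and "x \<notin> U"
      and U': "U' = insert x U" and H': "H' = delta_y H a b c x"
      by cases auto
    let ?t = "t(x := {a, b, c})"
    have x: "x \<notin> S" "x \<notin> verts G" using \<open>x \<notin> U\<close> U by auto
    have p': "triangle_packing G (insert x S) ?t"
      using triangle_stars[OF G p tri[unfolded H] x] .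
    have "stars G S ?t = stars G S t"
      using x(1) by (intro stars_cong) auto
    then have "H' = stars G (insert x S) ?t"
      using stars_insert(2)[OF G p' x(1)] H H' by simp
    moreover have "insert x S \<union> verts G \<subseteq> U'" using U U' by auto
    ultimately show ?thesis using p' by blast
  next
    assume "y_delta_step (U, H) (U', H')"
    then obtain x where x: "x \<in> verts H" "degree H x = 3"
      and U': "U' = U" and H': "H' = y_delta H x"
      by cases auto
    \<comment> \<open>A vertex of \<open>G\<close> still has degree at least \<open>7 / 2\<close>, which exceeds 3.\<close>
    have "x \<notin> verts G"
      using deg[of x] degree_le_degree_stars[OF G p, of x] x(2) H by auto
    then have "x \<in> S" using x(1) H by (simp add: stars_def)
    then have "H' = stars G (S - {x}) t"
      using y_delta_stars[OF G p] H H' by simp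
    moreover have "triangle_packing G (S - {x}) t"
      using p by (rule triangle_packing_mono) auto
    ultimately show ?thesis using U U' by blast
  qed
qed

theorem theorem2:
  fixes G :: "'a::infinite sgraph"
  assumes "simple_graph G"
    and "min_degree G \<ge> 7"
  shows "family G = delta_y_family G"
proof -
  have "degree G v \<ge> 7" if "v \<in> verts G" for v
  proof -
    have "min_degree G \<le> degree G v"
      using assms(1) that by (auto simp: min_degree_def simple_graph_def)
    with assms(2) show ?thesis by simp
  qed
  then have "obtained (sup delta_y_step y_delta_step) G \<subseteq> obtained delta_y_step G"
    using reachable_is_stars[OF assms(1)] delta_y_reaches_stars[OF assms(1)]
    unfolding obtained_def by blast
  moreover have "obtained delta_y_step G \<subseteq> obtained (sup delta_y_step y_delta_step) G"
    using rtranclp_mono[of delta_y_step "sup delta_y_step y_delta_step"]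
    unfolding obtained_def by auto
  ultimately show ?thesis
    unfolding family_def delta_y_family_def by simp
qed

end
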